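(* Let $G=(A\cup P,\mathcal{E})$ be an instance of the rank-maximal matching problem representing the true preferences, and let $a_1\in A$ be such that some rank-maximal matching of $G$ does not match $a_1$ to a rank one post, and such that $a_1$'s true preference list contains a non-$f$-post. Let $p_i$ be a highest ranked non-$f$-post in the true preference list of $a_1$. Let $H$ be obtained from $G$ by replacing the preference list of $a_1$ by a falsified full preference list in which $p_i$ is the unique rank one post and the remaining posts are placed arbitrarily at ranks greater than one (the preference lists of all other applicants unchanged). Then $H$ realizes strategy `best nonfirst': every rank-maximal matching of $H$ matches $a_1$ to $p_i$, and for every rank-maximal matching $M'$ of $G$ in which $a_1$ is matched to a post $q$ whose true rank is greater than one, the true rank of $p_i$ is at most the true rank of $q$.
   Context: An instance is a bipartite graph $G=(A\cup P,\mathcal{E})$ ($A$ = applicants, $P$ = posts) in which each edge $(a,p)$ has a positive integer rank describing $a$'s preference list (ties allowed; smaller rank = more preferred; "highest ranked" = smallest rank). A matching is a set of edges no two sharing an endpoint. The signature of a matching $M$ is $(x_1,\dots,x_r)$ ($r$ the largest rank) with $x_i$ the number of applicants matched in $M$ by a rank $i$ edge; a matching is rank-maximal if its signature is lexicographically largest among all matchings. A full preference list is one containing every post of $P$, without gaps in the ranks. $G_1$ denotes the subgraph of $G$ of rank one edges. For a bipartite graph $K$ with a maximum matching $M$, a vertex is even (resp. odd) if reachable from some $M$-unmatched vertex by an $M$-alternating path of even (resp. odd) length, and unreachable otherwise; these sets $E(K),O(K),U(K)$ do not depend on $M$. A post is an $f$-post (with respect to $a_1$) if it belongs to $O(K)\cup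 U(K)$, where $K$ is obtained from $G_1$ by deleting $a_1$; all other posts are non-$f$-posts. The strategy `best nonfirst' requires that $a_1$ is never matched to a post worse (in his true preferences) than the most preferred post among those of true rank greater than one that he can obtain in a rank-maximal matching when truthful. *)

theory Defs
  imports Main
begin

record 'v bigraph =
  applicants :: "'v set"
  posts :: "'v set"
  edges :: "('v \<times> 'v) set"

text \<open>The value of \<open>rank G a p\<close> is meaningful only when \<open>(a, p)\<close> is an edge.\<close>

record 'v rmm_instance = "'v bigraph" +
  rank :: "'v \<Rightarrow> 'v \<Rightarrow> nat"

definition bipartite :: "('v, 'm) bigraph_scheme \<Rightarrow> bool" where
  "bipartite K \<longleftrightarrow>
     finite (applicants K) \<and> finite (posts K) \<and> applicants K \<inter> posts K = {} \<and>
     edges K \<subseteq> applicants K \<times> posts K"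

definition is_instance :: "'v rmm_instance \<Rightarrow> bool" where
  "is_instance G \<longleftrightarrow> bipartite G \<and> (\<forall>(a, p) \<in> edges G. rank G a p \<ge> 1)"

definition pref_list :: "'v rmm_instance \<Rightarrow> 'v \<Rightarrow> 'v set" where
  "pref_list G a = {p. (a, p) \<in> edges G}"

definition matching :: "('v, 'm) bigraph_scheme \<Rightarrow> ('v \<times> 'v) set \<Rightarrow> bool" where
  "matching K M \<longleftrightarrow>
     M \<subseteq> edges K \<and>
     (\<forall>e \<in> M. \<forall>e' \<in> M. e \<noteq> e' \<longrightarrow> fst e \<noteq> fst e' \<and> snd e \<noteq> snd e')"

text \<open>The \<open>0\<close> only serves to make the maximum well defined for an edgeless graph.\<close>

definition max_rank :: "'v rmm_instance \<Rightarrow> nat" where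
  "max_rank G = Max (insert 0 ((\<lambda>(a, p). rank G a p) ` edges G))"

definition signature :: "'v rmm_instance \<Rightarrow> ('v \<times> 'v) set \<Rightarrow> nat list" where
  "signature G M =
     map (\<lambda>i. card {a \<in> applicants G. \<exists>p. (a, p) \<in> M \<and> rank G a p = i}) [1..<Suc (max_rank G)]"

definition rank_maximal :: "'v rmm_instance \<Rightarrow> ('v \<times> 'v) set \<Rightarrow> bool" where
  "rank_maximal G M \<longleftrightarrow>
     matching G M \<and>
     (\<forall>M'. matching G M' \<longrightarrow>
        signature G M' = signature G M \<or> (signature G M', signature G M) \<in> lex less_than)"

definition rank_one_graph :: "'v rmm_instance \<Rightarrow> 'v bigraph" where
  "rank_one_graph G =
     \<lparr>applicants = applicants G, posts = posts G,
      edges = {(a, p). (a, p) \<in> edges G \<and> rank G a p = 1}\<rparr>"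

definition delete_applicant :: "'v bigraph \<Rightarrow> 'v \<Rightarrow> 'v bigraph" where
  "delete_applicant K a =
     \<lparr>applicants = applicants K - {a}, posts = posts K,
      edges = {e \<in> edges K. fst e \<noteq> a}\<rparr>"

definition maximum_matching :: "('v, 'm) bigraph_scheme \<Rightarrow> ('v \<times> 'v) set \<Rightarrow> bool" where
  "maximum_matching K M \<longleftrightarrow> matching K M \<and> (\<forall>M'. matching K M' \<longrightarrow> card M' \<le> card M)"

definition vertices :: "('v, 'm) bigraph_scheme \<Rightarrow> 'v set" where
  "vertices K = applicants K \<union> posts K"

definition joined :: "('v \<times> 'v) set \<Rightarrow> 'v \<Rightarrow> 'v \<Rightarrow> bool" where
  "joined S u v \<longleftrightarrow> (u, v) \<in> S \<or> (v, u) \<in> S"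

definition unmatched :: "('v, 'm) bigraph_scheme \<Rightarrow> ('v \<times> 'v) set \<Rightarrow> 'v \<Rightarrow> bool" where
  "unmatched K M v \<longleftrightarrow> v \<in> vertices K \<and> (\<forall>u. \<not> joined M u v)"

text \<open>Paths are given by their nonempty vertex sequence \<open>xs\<close>, so their length is
  \<open>length xs - 1\<close>.\<close>

definition alternating_path ::
    "('v, 'm) bigraph_scheme \<Rightarrow> ('v \<times> 'v) set \<Rightarrow> 'v list \<Rightarrow> bool" where
  "alternating_path K M xs \<longleftrightarrow>
     xs \<noteq> [] \<and> distinct xs \<and> set xs \<subseteq> vertices K \<and>
     (\<forall>i. Suc i < length xs \<longrightarrow> joined (edges K) (xs ! i) (xs ! Suc i)) \<and>
     (\<forall>i. Suc (Suc i) < length xs \<longrightarrow>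
        (joined M (xs ! Suc i) (xs ! Suc (Suc i)) \<longleftrightarrow> \<not> joined M (xs ! i) (xs ! Suc i)))"

definition even_reachable ::
    "('v, 'm) bigraph_scheme \<Rightarrow> ('v \<times> 'v) set \<Rightarrow> 'v \<Rightarrow> bool" where
  "even_reachable K M v \<longleftrightarrow>
     (\<exists>xs. alternating_path K M xs \<and> unmatched K M (hd xs) \<and> last xs = v \<and>
           even (length xs - 1))"

definition odd_reachable ::
    "('v, 'm) bigraph_scheme \<Rightarrow> ('v \<times> 'v) set \<Rightarrow> 'v \<Rightarrow> bool" where
  "odd_reachable K M v \<longleftrightarrow>
     (\<exists>xs. alternating_path K M xs \<and> unmatched K M (hd xs) \<and> last xs = v \<and>
           odd (length xs - 1))"

text \<open>Reachability does not depend on the maximum matching, so the existential quantifiers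
  below could equally be universal ones.\<close>

definition even_vertices :: "('v, 'm) bigraph_scheme \<Rightarrow> 'v set" where
  "even_vertices K = {v \<in> vertices K. \<exists>M. maximum_matching K M \<and> even_reachable K M v}"

definition odd_vertices :: "('v, 'm) bigraph_scheme \<Rightarrow> 'v set" where
  "odd_vertices K = {v \<in> vertices K. \<exists>M. maximum_matching K M \<and> odd_reachable K M v}"

definition unreachable_vertices :: "('v, 'm) bigraph_scheme \<Rightarrow> 'v set" where
  "unreachable_vertices K = vertices K - even_vertices K - odd_vertices K"

definition f_post :: "'v rmm_instance \<Rightarrow> 'v \<Rightarrow> 'v \<Rightarrow> bool" where
  "f_post G a p \<longleftrightarrow>
     (let K = delete_applicant (rank_one_graph G) a
      in p \<in> posts G \<and> p \<in> odd_vertices K \<union> unreachable_vertices K)"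

definition non_f_post :: "'v rmm_instance \<Rightarrow> 'v \<Rightarrow> 'v \<Rightarrow> bool" where
  "non_f_post G a p \<longleftrightarrow> p \<in> posts G \<and> \<not> f_post G a p"

definition highest_ranked_non_f_post :: "'v rmm_instance \<Rightarrow> 'v \<Rightarrow> 'v \<Rightarrow> bool" where
  "highest_ranked_non_f_post G a p \<longleftrightarrow>
     p \<in> pref_list G a \<and> non_f_post G a p \<and>
     (\<forall>q \<in> pref_list G a. non_f_post G a q \<longrightarrow> rank G a p \<le> rank G a q)"

definition full_pref_list :: "'v rmm_instance \<Rightarrow> 'v \<Rightarrow> bool" where
  "full_pref_list G a \<longleftrightarrow>
     pref_list G a = posts G \<and>
     (\<forall>p \<in> pref_list G a. \<forall>j. 1 \<le> j \<and> j \<le> rank G a p \<longrightarrow> (\<exists>q \<in> pref_list G a. rank G a q = j))"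

definition differs_only_in_list_of ::
    "'v rmm_instance \<Rightarrow> 'v \<Rightarrow> 'v rmm_instance \<Rightarrow> bool" where
  "differs_only_in_list_of G a H \<longleftrightarrow>
     applicants H = applicants G \<and> posts H = posts G \<and>
     (\<forall>b. b \<noteq> a \<longrightarrow>
        pref_list H b = pref_list G b \<and> (\<forall>p \<in> pref_list G b. rank H b p = rank G b p))"

definition truthful_nonfirst_posts :: "'v rmm_instance \<Rightarrow> 'v \<Rightarrow> 'v set" where
  "truthful_nonfirst_posts G a =
     {q. \<exists>M. rank_maximal G M \<and> (a, q) \<in> M \<and> rank G a q > 1}"

text \<open>\<open>G\<close> holds the true preferences and \<open>H\<close> the falsified ones. Being left unmatched, or
  matched to a post outside the true preference list, counts as worse than any listed post.\<close>

definition realizes_best_nonfirst ::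
    "'v rmm_instance \<Rightarrow> 'v \<Rightarrow> 'v rmm_instance \<Rightarrow> bool" where
  "realizes_best_nonfirst G a H \<longleftrightarrow>
     (\<forall>q. is_arg_min (rank G a) (\<lambda>q. q \<in> truthful_nonfirst_posts G a) q \<longrightarrow>
        (\<forall>M. rank_maximal H M \<longrightarrow>
           (\<exists>p \<in> pref_list G a. (a, p) \<in> M \<and> rank G a p \<le> rank G a q)))"

end

theory Submission
  imports Defs
begin

text \<open>Deleting \<open>a1\<close> from the rank one graph leaves a graph \<open>K\<close> whose non-f-posts are exactly the
  posts missed by some maximum matching of \<open>K\<close>. In \<open>H\<close> such a post \<open>pi\<close> can be given to \<open>a1\<close> on
  top of a maximum matching of \<open>K\<close>, so rank one edges can only be maximal in number if \<open>(a1, pi)\<close>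
  is used. Conversely, if a rank-maximal matching of \<open>G\<close> gives \<open>a1\<close> a post \<open>q\<close> of larger rank,
  its rank one edges form a maximum matching of \<open>K\<close> missing \<open>q\<close>, so \<open>q\<close> is a non-f-post.\<close>

section \<open>Elementary facts on matchings\<close>

lemma matchingD_fst: "matching K M \<Longrightarrow> (a, p) \<in> M \<Longrightarrow> (a, q) \<in> M \<Longrightarrow> p = q"
  unfolding matching_def by fastforce

lemma matchingD_snd: "matching K M \<Longrightarrow> (a, p) \<in> M \<Longrightarrow> (b, p) \<in> M \<Longrightarrow> a = b"
  unfolding matching_def by fastforce

lemma matchingD_edges: "matching K M \<Longrightarrow> M \<subseteq> edges K"
  unfolding matching_def by blast

lemma matchingI:
  assumes "M \<subseteq> edges K"
    and "\<And>a p q. (a, p) \<in> M \<Longrightarrow> (a, q) \<in> M \<Longrightarrow> p = q"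
    and "\<And>a b p. (a, p) \<in> M \<Longrightarrow> (b, p) \<in> M \<Longrightarrow> a = b"
  shows "matching K M"
  unfolding matching_def using assms by fastforce

lemma finite_edges: "bipartite K \<Longrightarrow> finite (edges K)"
  unfolding bipartite_def by (meson finite_SigmaI finite_subset)

lemma finite_matching: "bipartite K \<Longrightarrow> matching K M \<Longrightarrow> finite M"
  by (meson finite_edges finite_subset matchingD_edges)

lemma maximum_matchingI_card:
  assumes "maximum_matching K M" "matching K N" "card M \<le> card N"
  shows "maximum_matching K N"
  using assms unfolding maximum_matching_def by (meson le_trans)

section \<open>Moving the missed vertex along an alternating path\<close>

text \<open>Trading the matched edge \<open>v w\<close> for \<open>u v\<close> keeps the size and
  moves the missed vertex from \<open>u\<close> to \<open>w\<close>. The last conclusion lets the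
  rest of an alternating path, which avoids \<open>u\<close> and \<open>v\<close>, stay alternating
  for the new matching.\<close>

lemma maximum_matching_switch:
  assumes bip: "bipartite K" and max: "maximum_matching K M"
    and un: "unmatched K M u" and uv: "joined (edges K) u v"
    and vw: "joined M v w" and wu: "w \<noteq> u"
  obtains N where "maximum_matching K N" "unmatched K N w"
    "\<And>x y. x \<notin> {u, v} \<Longrightarrow> y \<notin> {u, v} \<Longrightarrow> joined N x y \<longleftrightarrow> joined M x y"
proof -
  have M: "matching K M" using max by (simp add: maximum_matching_def)
  have fin: "finite M" by (rule finite_matching[OF bip M])
  have sub: "edges K \<subseteq> applicants K \<times> posts K" "applicants K \<inter> posts K = {}"
    using bip by (auto simp: bipartite_def)
  have ME: "M \<subseteq> edges K" by (rule matchingD_edges[OF M])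
  have unj: "(u, x) \<notin> M" "(x, u) \<notin> M" for x
    using un by (auto simp: unmatched_def joined_def)
  consider (l) "(u, v) \<in> edges K" | (r) "(v, u) \<in> edges K"
    using uv by (auto simp: joined_def)
  then show thesis
  proof cases
    case l
    define N where "N = insert (u, v) (M - {(w, v)})"
    \<comment> \<open>Here \<open>u\<close> is an applicant and \<open>v\<close> a post, which fixes
      the orientation of the matched edge at \<open>v\<close>; the other case is the mirror
      image.\<close>
    have wv: "(w, v) \<in> M" using vw l sub ME by (auto simp: joined_def)
    have N: "matching K N"
      using ME l unj matchingD_fst[OF M] matchingD_snd[OF M] wv
      by (intro matchingI) (auto simp: N_def)
    have "card N = card M"
      using fin unj card_Suc_Diff1[OF fin wv] by (simp add: N_def)
    then have 1: "maximum_matching K N"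
      using maximum_matchingI_card[OF max N] by simp
    have "w \<in> applicants K" "v \<in> posts K" using wv ME sub by auto
    then have "(w, x) \<notin> N" "(x, w) \<notin> N" for x
      using wu ME sub matchingD_fst[OF M wv] by (auto simp: N_def)
    then have 2: "unmatched K N w"
      using \<open>w \<in> applicants K\<close> by (auto simp: unmatched_def joined_def vertices_def)
    show thesis by (rule that[OF 1 2]) (auto simp: joined_def N_def)
  next
    case r
    define N where "N = insert (v, u) (M - {(v, w)})"
    have wv: "(v, w) \<in> M" using vw r sub ME by (auto simp: joined_def)
    have N: "matching K N"
      using ME r unj matchingD_fst[OF M] matchingD_snd[OF M] wv
      by (intro matchingI) (auto simp: N_def)
    have "card N = card M"
      using fin unj card_Suc_Diff1[OF fin wv] by (simp add: N_def)
    then have 1: "maximum_matching K N"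
      using maximum_matchingI_card[OF max N] by simp
    have "w \<in> posts K" "v \<in> applicants K" using wv ME sub by auto
    then have "(w, x) \<notin> N" "(x, w) \<notin> N" for x
      using wu ME sub matchingD_snd[OF M wv] by (auto simp: N_def)
    then have 2: "unmatched K N w"
      using \<open>w \<in> posts K\<close> by (auto simp: unmatched_def joined_def vertices_def)
    show thesis by (rule that[OF 1 2]) (auto simp: joined_def N_def)
  qed
qed

lemma alternating_path_drop2:
  assumes alt: "alternating_path K M (u # v # w # xs)"
    and eq: "\<And>x y. x \<notin> {u, v} \<Longrightarrow> y \<notin> {u, v} \<Longrightarrow> joined N x y \<longleftrightarrow> joined M x y"
  shows "alternating_path K N (w # xs)"
  unfolding alternating_path_def
proof (intro conjI allI impI)
  let ?ys = "w # xs"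
  show "?ys \<noteq> []" "distinct ?ys" "set ?ys \<subseteq> vertices K"
    using alt by (auto simp: alternating_path_def)
  \<comment> \<open>The path is distinct, so its remaining vertices avoid the only places where
    \<open>M\<close> and \<open>N\<close> may differ.\<close>
  have off: "?ys ! i \<notin> {u, v}" if "i < length ?ys" for i
    using alt nth_mem[OF that] by (auto simp: alternating_path_def)
  fix i
  show "joined (edges K) (?ys ! i) (?ys ! Suc i)" if "Suc i < length ?ys"
    using alt that unfolding alternating_path_def
    by (auto dest!: spec[of _ "Suc (Suc i)"])
  assume i: "Suc (Suc i) < length ?ys"
  have "joined M (?ys ! Suc i) (?ys ! Suc (Suc i)) \<longleftrightarrow> \<not> joined M (?ys ! i) (?ys ! Suc i)"
    using alt i unfolding alternating_path_def
    by (auto dest!: spec[of _ "Suc (Suc i)"])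
  then show "joined N (?ys ! Suc i) (?ys ! Suc (Suc i)) \<longleftrightarrow> \<not> joined N (?ys ! i) (?ys ! Suc i)"
    using i by (simp only: eq[OF off off] Suc_lessD)
qed

text \<open>Each switch consumes two edges of the path and changes the matching, so the induction
  generalizes over \<open>M\<close>. A single vertex remains if the length is even, a single edge if
  it is odd.\<close>

lemma alternating_path_switch:
  assumes bip: "bipartite K"
  shows "maximum_matching K M \<Longrightarrow> alternating_path K M xs \<Longrightarrow> unmatched K M (hd xs) \<Longrightarrow>
    \<exists>N. maximum_matching K N \<and>
      (if even (length xs - 1) then unmatched K N (last xs)
       else \<exists>b. unmatched K N b \<and> joined (edges K) b (last xs))"
proof (induction "length xs" arbitrary: xs M rule: less_induct)
  case less
  consider "xs = []" | u where "xs = [u]" | u v where "xs = [u, v]"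
    | u v w ys where "xs = u # v # w # ys"
    by (metis list.exhaust)
  then show ?case
  proof cases
    case 1
    with less.prems show ?thesis by (simp add: alternating_path_def)
  next
    case 2
    with less.prems show ?thesis by auto
  next
    case (3 u v)
    \<comment> \<open>One edge is left, and its missed end \<open>u\<close> serves as
      \<open>b\<close>.\<close>
    with less.prems have "unmatched K M u" "joined (edges K) u v"
      by (auto simp: alternating_path_def)
    with less.prems(1) 3 show ?thesis by auto
  next
    case (4 u v w ys)
    have un: "unmatched K M u" using less.prems 4 by simp
    have uv: "joined (edges K) u v" and "joined M v w \<longleftrightarrow> \<not> joined M u v" and wu: "w \<noteq> u"
      using less.prems(2) 4 by (auto simp: alternating_path_def)
    \<comment> \<open>A path from a missed vertex starts with an unmatched edge, so alternation
      makes its second edge matched.\<close>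
    moreover have "\<not> joined M u v" using un by (auto simp: unmatched_def joined_def)
    ultimately have vw: "joined M v w" by blast
    obtain N where N: "maximum_matching K N" "unmatched K N w"
      and eq: "\<And>x y. x \<notin> {u, v} \<Longrightarrow> y \<notin> {u, v} \<Longrightarrow> joined N x y \<longleftrightarrow> joined M x y"
      using maximum_matching_switch[OF bip less.prems(1) un uv vw wu] by blast
    have "alternating_path K N (w # ys)"
      using alternating_path_drop2[OF _ eq] less.prems(2) 4 by blast
    \<comment> \<open>The path has \<open>length ys + 2\<close> edges and its tail
      \<open>length ys\<close>, so the parity is preserved.\<close>
    from less.hyps[OF _ N(1) this] N(2) 4
    obtain L where "maximum_matching K L"
      "if even (length ys) then unmatched K L (last (w # ys))
       else \<exists>b. unmatched K L b \<and> joined (edges K) b (last (w # ys))"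
      by auto
    with 4 show ?thesis by (intro exI[of _ L]) (auto split: if_splits)
  qed
qed

section \<open>Comparing two maximum matchings by exchange\<close>

text \<open>The posts of the component of \<open>q\<close> in the symmetric difference of \<open>M\<close> and \<open>N\<close>.\<close>

inductive_set switch_posts :: "('v \<times> 'v) set \<Rightarrow> ('v \<times> 'v) set \<Rightarrow> 'v \<Rightarrow> 'v set"
  for M N q where
  base: "q \<in> switch_posts M N q"
| step: "p \<in> switch_posts M N q \<Longrightarrow> (x, p) \<in> M \<Longrightarrow> (x, p') \<in> N \<Longrightarrow> p' \<in> switch_posts M N q"

text \<open>Exchanging \<open>M\<close> and \<open>N\<close> on that component yields two matchings of the same total
  size, so both are maximum; the one derived from \<open>M\<close> misses both \<open>b\<close> and \<open>q\<close>.\<close>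

lemma no_edge_between_missed:
  assumes bip: "bipartite K" and maxM: "maximum_matching K M" and maxN: "maximum_matching K N"
    and b: "\<And>p. (b, p) \<notin> M" and q: "\<And>a. (a, q) \<notin> N"
  shows "(b, q) \<notin> edges K"
proof
  assume bq: "(b, q) \<in> edges K"
  have M: "matching K M" and N: "matching K N"
    using maxM maxN by (auto simp: maximum_matching_def)
  have fin: "finite M" "finite N" using finite_matching[OF bip] M N by auto
  note ME = matchingD_edges[OF M] and NE = matchingD_edges[OF N]
  define Q where "Q = switch_posts M N q"
  \<comment> \<open>\<open>B\<close> consists of the applicants of the component; \<open>MQ\<close>
    and \<open>NB\<close> are its edges in \<open>M\<close> and in \<open>N\<close>.\<close>
  define MQ where "MQ = {(x, p) \<in> M. p \<in> Q}"
  define B where "B = {x. \<exists>p\<in>Q. (x, p) \<in> M}"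
  define NB where "NB = {(x, p) \<in> N. x \<in> B}"
  have qQ: "q \<in> Q" by (simp add: Q_def switch_posts.base)
  have forward: "p' \<in> Q" if "x \<in> B" "(x, p') \<in> N" for x p'
    using that switch_posts.step by (force simp: B_def Q_def)
  \<comment> \<open>A post enters the component through an \<open>N\<close>-edge from an applicant
    in \<open>B\<close>, except for \<open>q\<close>, which \<open>N\<close> misses.\<close>
  have backward: "x \<in> B" if "p \<in> Q" "(x, p) \<in> N" for x p
    using that(1)[unfolded Q_def]
  proof cases
    case base
    with that(2) q show ?thesis by blast
  next
    case (step p' y)
    with that(2) matchingD_snd[OF N] have "y = x" by blast
    with step show ?thesis by (auto simp: B_def Q_def)
  qed
  have MQB: "(x, p) \<in> MQ" if "(x, p) \<in> M" "x \<in> B" for x p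
    using that matchingD_fst[OF M] by (auto simp: MQ_def B_def)
  have MQ_sub: "MQ \<subseteq> M" "NB \<subseteq> N" by (auto simp: MQ_def NB_def)
  define M1 where "M1 = (M - MQ) \<union> NB"
  define N1 where "N1 = (N - NB) \<union> MQ"
  \<comment> \<open>Edges taken from \<open>M\<close> and from \<open>N\<close> have no endpoint in
    common: one kind lies outside \<open>B\<close> and \<open>Q\<close>, the other inside. Hence the
    exchange yields matchings.\<close>
  have M1_cases: "(x, p) \<in> M \<and> x \<notin> B \<and> p \<notin> Q \<or> (x, p) \<in> N \<and> x \<in> B \<and> p \<in> Q"
    if "(x, p) \<in> M1" for x p
  proof (cases "(x, p) \<in> NB")
    case True
    then show ?thesis using forward by (auto simp: NB_def)
  next
    case False
    with that have "(x, p) \<in> M" "(x, p) \<notin> MQ" by (auto simp: M1_def)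
    with MQB show ?thesis by (auto simp: MQ_def)
  qed
  have N1_cases: "(x, p) \<in> N \<and> x \<notin> B \<and> p \<notin> Q \<or> (x, p) \<in> M \<and> x \<in> B \<and> p \<in> Q"
    if "(x, p) \<in> N1" for x p
  proof (cases "(x, p) \<in> MQ")
    case True
    then show ?thesis by (auto simp: MQ_def B_def)
  next
    case False
    with that have "(x, p) \<in> N" "(x, p) \<notin> NB" by (auto simp: N1_def)
    with backward show ?thesis by (auto simp: NB_def)
  qed
  have M1: "matching K M1"
  proof (rule matchingI)
    show "M1 \<subseteq> edges K" using ME NE MQ_sub by (auto simp: M1_def)
    show "p = p'" if "(x, p) \<in> M1" "(x, p') \<in> M1" for x p p'
      using M1_cases[OF that(1)] M1_cases[OF that(2)] matchingD_fst[OF M] matchingD_fst[OF N]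
      by blast
    show "x = y" if "(x, p) \<in> M1" "(y, p) \<in> M1" for x y p
      using M1_cases[OF that(1)] M1_cases[OF that(2)] matchingD_snd[OF M] matchingD_snd[OF N]
      by blast
  qed
  have N1: "matching K N1"
  proof (rule matchingI)
    show "N1 \<subseteq> edges K" using ME NE MQ_sub by (auto simp: N1_def)
    show "p = p'" if "(x, p) \<in> N1" "(x, p') \<in> N1" for x p p'
      using N1_cases[OF that(1)] N1_cases[OF that(2)] matchingD_fst[OF M] matchingD_fst[OF N]
      by blast
    show "x = y" if "(x, p) \<in> N1" "(y, p) \<in> N1" for x y p
      using N1_cases[OF that(1)] N1_cases[OF that(2)] matchingD_snd[OF M] matchingD_snd[OF N]
      by blast
  qed
  have finQ: "finite MQ" "finite NB" using fin MQ_sub finite_subset by blast+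
  \<comment> \<open>An edge common to \<open>M\<close> and \<open>N\<close> lies in
    \<open>MQ\<close> exactly if it lies in \<open>NB\<close>, so the sizes simply add up.\<close>
  have "(M - MQ) \<inter> NB = {}" "(N - NB) \<inter> MQ = {}"
    using MQB by (auto simp: NB_def MQ_def B_def)
  then have "card M1 = card (M - MQ) + card NB" "card N1 = card (N - NB) + card MQ"
    unfolding M1_def N1_def using fin finQ by (simp_all add: card_Un_disjoint)
  moreover have "card (M - MQ) + card MQ = card M" "card (N - NB) + card NB = card N"
    using fin finQ MQ_sub by (simp_all add: card_Diff_subset card_mono)
  moreover have "card N1 \<le> card N" using maxN N1 by (simp add: maximum_matching_def)
  ultimately have le: "card M \<le> card M1" by linarith
  \<comment> \<open>\<open>b\<close> is outside \<open>B\<close> because \<open>M\<close> misses it,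
    while \<open>q\<close> is in \<open>Q\<close> and missed by \<open>N\<close>. Thus
    \<open>(b, q)\<close> would enlarge \<open>M1\<close> beyond the maximum.\<close>
  have b1: "(b, p) \<notin> M1" and q1: "(x, q) \<notin> M1" for p x
    using M1_cases[of b p] M1_cases[of x q] b q qQ by (auto simp: B_def)
  have "matching K (insert (b, q) M1)"
    using matchingD_edges[OF M1] bq b1 q1 matchingD_fst[OF M1] matchingD_snd[OF M1]
    by (intro matchingI) auto
  then have "card (insert (b, q) M1) \<le> card M" using maxM by (simp add: maximum_matching_def)
  moreover have "finite M1" using finite_matching[OF bip M1] .
  ultimately show False using b1 le by simp
qed

section \<open>Even and odd posts in terms of missed vertices\<close>

lemma even_vertices_missed:
  assumes "bipartite K" "v \<in> even_vertices K"
  obtains N where "maximum_matching K N" "unmatched K N v"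
proof -
  obtain M xs where "maximum_matching K M" "alternating_path K M xs" "unmatched K M (hd xs)"
    "last xs = v" "even (length xs - 1)"
    using assms(2) by (auto simp: even_vertices_def even_reachable_def)
  with alternating_path_switch[OF assms(1), of M xs] that show thesis by auto
qed

lemma missed_even_vertex:
  assumes "maximum_matching K M" "unmatched K M v"
  shows "v \<in> even_vertices K"
proof -
  have "alternating_path K M [v]"
    using assms by (simp add: alternating_path_def unmatched_def)
  then have "even_reachable K M v"
    using assms unfolding even_reachable_def by (intro exI[of _ "[v]"]) simp
  with assms show ?thesis by (auto simp: even_vertices_def unmatched_def)
qed

text \<open>Switching along an odd path to \<open>q\<close> would leave some neighbour
  \<open>b\<close> of \<open>q\<close> missed by a maximum matching. That matching may differ from
  \<open>M\<close>, which is why \<open>no_edge_between_missed\<close> compares two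
  matchings.\<close>

lemma missed_post_not_odd:
  assumes bip: "bipartite K" and max: "maximum_matching K M" and un: "unmatched K M q"
    and q: "q \<in> posts K"
  shows "q \<notin> odd_vertices K"
proof
  assume "q \<in> odd_vertices K"
  then obtain M' xs where "maximum_matching K M'" "alternating_path K M' xs"
    "unmatched K M' (hd xs)" "last xs = q" "odd (length xs - 1)"
    by (auto simp: odd_vertices_def odd_reachable_def)
  with alternating_path_switch[OF bip, of M' xs] obtain N b
    where N: "maximum_matching K N" "unmatched K N b" "joined (edges K) b q" by auto
  have "(b, q) \<in> edges K"
    using N(3) q bip by (auto simp: joined_def bipartite_def)
  moreover have "(b, q) \<notin> edges K"
    by (rule no_edge_between_missed[OF bip N(1) max])
      (use N(2) un in \<open>auto simp: unmatched_def joined_def\<close>)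
  ultimately show False by blast
qed

section \<open>Rank one edges and the first signature entry\<close>

definition rank_one_part :: "'v rmm_instance \<Rightarrow> ('v \<times> 'v) set \<Rightarrow> ('v \<times> 'v) set" where
  "rank_one_part G M = {(a, p) \<in> M. rank G a p = 1}"

text \<open>Signatures count applicants and maximum matchings count edges; the two agree since
  \<open>fst\<close> is injective on a matching.\<close>

lemma card_rank_one_part:
  assumes "bipartite G" "matching G M"
  shows "card {a \<in> applicants G. \<exists>p. (a, p) \<in> M \<and> rank G a p = 1} = card (rank_one_part G M)"
proof -
  have "{a \<in> applicants G. \<exists>p. (a, p) \<in> M \<and> rank G a p = 1} = fst ` rank_one_part G M"
    using assms matchingD_edges[OF assms(2)]
    by (force simp: rank_one_part_def bipartite_def)
  moreover have "inj_on fst (rank_one_part G M)"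
    using matchingD_fst[OF assms(2)] by (auto simp: inj_on_def rank_one_part_def)
  ultimately show ?thesis by (simp add: card_image)
qed

lemma rank_le_max_rank:
  assumes "bipartite G" "(a, p) \<in> edges G"
  shows "rank G a p \<le> max_rank G"
proof -
  have "rank G a p \<in> (\<lambda>(a, p). rank G a p) ` edges G"
    using assms(2) by force
  with finite_edges[OF assms(1)] show ?thesis by (simp add: max_rank_def)
qed

text \<open>The lexicographic order compares first entries first. The bound on
  \<open>max_rank G\<close> ensures that the signature has a first entry.\<close>

lemma rank_maximal_rank_one_part:
  assumes bip: "bipartite G" and r: "1 \<le> max_rank G"
    and M: "rank_maximal G M" and N: "matching G N"
  shows "card (rank_one_part G N) \<le> card (rank_one_part G M)"
proof -
  have m: "matching G M" using M by (simp add: rank_maximal_def)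
  have "[1..<Suc (max_rank G)] = 1 # [Suc 1..<Suc (max_rank G)]"
    using r by (intro upt_conv_Cons) simp
  then have sig: "\<exists>ys. signature G X = card (rank_one_part G X) # ys" if "matching G X" for X
    using card_rank_one_part[OF bip that] by (simp add: signature_def)
  obtain xs ys where "signature G M = card (rank_one_part G M) # xs"
    "signature G N = card (rank_one_part G N) # ys"
    using sig[OF m] sig[OF N] by blast
  moreover have "signature G N = signature G M \<or> (signature G N, signature G M) \<in> lex less_than"
    using M N by (simp add: rank_maximal_def)
  ultimately show ?thesis by auto
qed

lemma matching_subset: "matching G M \<Longrightarrow> N \<subseteq> M \<Longrightarrow> N \<subseteq> edges K \<Longrightarrow> matching K N"
  unfolding matching_def by blast

section \<open>The rank one graph without one applicant, and its non-f-posts\<close>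

lemma edges_delete_applicant_rank_one:
  "(b, p) \<in> edges (delete_applicant (rank_one_graph G) a) \<longleftrightarrow>
     (b, p) \<in> edges G \<and> rank G b p = 1 \<and> b \<noteq> a"
  by (auto simp: delete_applicant_def rank_one_graph_def)

lemma bipartite_delete_applicant_rank_one:
  "bipartite G \<Longrightarrow> bipartite (delete_applicant (rank_one_graph G) a)"
  by (auto simp: bipartite_def delete_applicant_def rank_one_graph_def)

lemma posts_delete_applicant_rank_one:
  "posts (delete_applicant (rank_one_graph G) a) = posts G"
  by (simp add: delete_applicant_def rank_one_graph_def)

text \<open>Even and odd vertices are not disjoint by definition, so avoiding the odd ones stays a
  separate condition.\<close>

lemma non_f_post_iff:
  "non_f_post G a p \<longleftrightarrow> p \<in> posts G \<and>
     p \<in> even_vertices (delete_applicant (rank_one_graph G) a) \<and>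
     p \<notin> odd_vertices (delete_applicant (rank_one_graph G) a)"
  by (auto simp: non_f_post_def f_post_def Let_def unreachable_vertices_def vertices_def
      posts_delete_applicant_rank_one)

lemma nonfirst_post_is_non_f_post:
  assumes bip: "bipartite G" and M: "rank_maximal G M"
    and q: "(a, q) \<in> M" "rank G a q > 1"
  shows "non_f_post G a q"
proof -
  let ?K = "delete_applicant (rank_one_graph G) a"
  have m: "matching G M" using M by (simp add: rank_maximal_def)
  have qE: "(a, q) \<in> edges G" using matchingD_edges[OF m] q by blast
  then have qP: "q \<in> posts G" using bip by (auto simp: bipartite_def)
  have r: "1 \<le> max_rank G" using rank_le_max_rank[OF bip qE] q(2) by linarith
  \<comment> \<open>The only edge of \<open>M\<close> at \<open>a\<close> has rank above one, so the
    rank one part avoids \<open>a\<close>.\<close>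
  have "rank_one_part G M \<subseteq> edges ?K"
    using matchingD_edges[OF m] matchingD_fst[OF m q(1)] q(2)
    by (auto simp: rank_one_part_def edges_delete_applicant_rank_one)
  moreover have "rank_one_part G M \<subseteq> M" by (auto simp: rank_one_part_def)
  ultimately have K: "matching ?K (rank_one_part G M)" by (meson m matching_subset)
  have max: "maximum_matching ?K (rank_one_part G M)"
    unfolding maximum_matching_def
  proof (intro conjI allI impI K)
    fix N assume N: "matching ?K N"
    have NE: "N \<subseteq> edges ?K" by (rule matchingD_edges[OF N])
    then have "N \<subseteq> edges G" by (auto simp: edges_delete_applicant_rank_one)
    then have "matching G N" using matching_subset[OF N] by blast
    \<comment> \<open>A matching of \<open>?K\<close> consists of rank one edges of
      \<open>G\<close>, so its whole size is bounded by the first signature entry of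
      \<open>M\<close>.\<close>
    moreover have "rank_one_part G N = N"
      using NE by (auto simp: rank_one_part_def edges_delete_applicant_rank_one)
    ultimately show "card N \<le> card (rank_one_part G M)"
      using rank_maximal_rank_one_part[OF bip r M] by metis
  qed
  have "(u, q) \<notin> rank_one_part G M" for u
    using matchingD_snd[OF m q(1)] q(2) by (auto simp: rank_one_part_def)
  moreover have "(q, u) \<notin> rank_one_part G M" for u
    using matchingD_edges[OF m] bip qP by (auto simp: rank_one_part_def bipartite_def)
  ultimately have un: "unmatched ?K (rank_one_part G M) q"
    using qP by (auto simp: unmatched_def joined_def vertices_def posts_delete_applicant_rank_one)
  show ?thesis
    unfolding non_f_post_iff
    using qP missed_even_vertex[OF max un]
      missed_post_not_odd[OF bipartite_delete_applicant_rank_one[OF bip] max un]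
    by (simp add: posts_delete_applicant_rank_one)
qed

section \<open>The effect of the falsified list\<close>

lemma rank_maximal_matches_unique_first:
  assumes bip: "bipartite G" and a: "a \<in> applicants G"
    and p: "non_f_post G a p" and H: "differs_only_in_list_of G a H"
    and full: "full_pref_list H a" and r1: "rank H a p = 1"
    and others: "\<forall>q \<in> posts G. q \<noteq> p \<longrightarrow> rank H a q > 1"
    and M: "rank_maximal H M"
  shows "(a, p) \<in> M"
proof (rule ccontr)
  assume apM: "(a, p) \<notin> M"
  let ?K = "delete_applicant (rank_one_graph G) a"
  have AP: "applicants H = applicants G" "posts H = posts G"
    and edge_ne: "\<And>b q. b \<noteq> a \<Longrightarrow> (b, q) \<in> edges H \<longleftrightarrow> (b, q) \<in> edges G"
    and rank_ne: "\<And>b q. b \<noteq> a \<Longrightarrow> (b, q) \<in> edges G \<Longrightarrow> rank H b q = rank G b q"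
    using H by (auto simp: differs_only_in_list_of_def pref_list_def)
  have edge_a: "(a, q) \<in> edges H \<longleftrightarrow> q \<in> posts G" for q
    using full AP by (auto simp: full_pref_list_def pref_list_def)
  have bipH: "bipartite H"
    unfolding bipartite_def
  proof (intro conjI)
    show "edges H \<subseteq> applicants H \<times> posts H"
    proof (rule subrelI)
      fix b q assume "(b, q) \<in> edges H"
      then show "(b, q) \<in> applicants H \<times> posts H"
        using edge_ne edge_a AP a bip by (cases "b = a") (auto simp: bipartite_def)
    qed
  qed (use bip AP in \<open>auto simp: bipartite_def\<close>)
  have pP: "p \<in> posts G" and "p \<in> even_vertices ?K" using p by (auto simp: non_f_post_iff)
  then obtain N where N: "maximum_matching ?K N" and un: "unmatched ?K N p"
    using even_vertices_missed[OF bipartite_delete_applicant_rank_one[OF bip]] by blast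
  have mN: "matching ?K N" using N by (simp add: maximum_matching_def)
  note NK = matchingD_edges[OF mN]
  have finN: "finite N"
    using finite_matching[OF bipartite_delete_applicant_rank_one[OF bip] mN] .
  have Np: "(x, p) \<notin> N" and Na: "(a, x) \<notin> N" for x
    using un NK by (auto simp: unmatched_def joined_def edges_delete_applicant_rank_one)
  have apH: "(a, p) \<in> edges H" using edge_a pP by blast
  have N': "matching H (insert (a, p) N)"
  proof (rule matchingI)
    show "insert (a, p) N \<subseteq> edges H"
      using NK apH edge_ne by (auto simp: edges_delete_applicant_rank_one)
  qed (use Np Na matchingD_fst[OF mN] matchingD_snd[OF mN] in auto)
  \<comment> \<open>The edges of \<open>N\<close> avoid \<open>a\<close> and so keep rank one in
    \<open>H\<close>; this forces at least \<open>card N + 1\<close> rank one edges in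
    \<open>M\<close>.\<close>
  have "rank_one_part H (insert (a, p) N) = insert (a, p) N"
    using NK r1 rank_ne by (auto simp: rank_one_part_def edges_delete_applicant_rank_one)
  moreover have "1 \<le> max_rank H" using rank_le_max_rank[OF bipH apH] r1 by simp
  ultimately have "card (insert (a, p) N) \<le> card (rank_one_part H M)"
    using rank_maximal_rank_one_part[OF bipH _ M N'] by simp
  moreover have "card (rank_one_part H M) \<le> card N"
  proof -
    have m: "matching H M" using M by (simp add: rank_maximal_def)
    have "rank_one_part H M \<subseteq> edges ?K"
    proof (rule subrelI)
      fix b q assume bq: "(b, q) \<in> rank_one_part H M"
      then have e: "(b, q) \<in> M" "(b, q) \<in> edges H" "rank H b q = 1"
        using matchingD_edges[OF m] by (auto simp: rank_one_part_def)
      \<comment> \<open>In \<open>H\<close> the only rank one edge at \<open>a\<close> is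
        \<open>(a, p)\<close>, which \<open>M\<close> is assumed to avoid.\<close>
      then have "b \<noteq> a" using others edge_a apM by fastforce
      with e show "(b, q) \<in> edges ?K"
        using edge_ne rank_ne by (simp add: edges_delete_applicant_rank_one)
    qed
    moreover have "rank_one_part H M \<subseteq> M" by (auto simp: rank_one_part_def)
    ultimately have "matching ?K (rank_one_part H M)" by (meson m matching_subset)
    with N show ?thesis by (simp add: maximum_matching_def)
  qed
  ultimately show False using finN Na by simp
qed

theorem theorem1:
  fixes G H :: "'v rmm_instance" and a1 pi :: 'v
  assumes "is_instance G"
    and "a1 \<in> applicants G"
    and "\<exists>M. rank_maximal G M \<and> \<not> (\<exists>p. (a1, p) \<in> M \<and> rank G a1 p = 1)"
    and "\<exists>p \<in> pref_list G a1. non_f_post G a1 p"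
    and "highest_ranked_non_f_post G a1 pi"
    and "differs_only_in_list_of G a1 H"
    and "full_pref_list H a1"
    and "rank H a1 pi = 1"
    and "\<forall>p \<in> posts G. p \<noteq> pi \<longrightarrow> rank H a1 p > 1"
  shows "realizes_best_nonfirst G a1 H \<and>
    (\<forall>M. rank_maximal H M \<longrightarrow> (a1, pi) \<in> M) \<and>
    (\<forall>M' q. rank_maximal G M' \<and> (a1, q) \<in> M' \<and> rank G a1 q > 1 \<longrightarrow>
       rank G a1 pi \<le> rank G a1 q)"
proof -
  have bip: "bipartite G" using assms(1) by (simp add: is_instance_def)
  have pi: "pi \<in> pref_list G a1" "non_f_post G a1 pi"
    and best: "\<And>q. q \<in> pref_list G a1 \<Longrightarrow> non_f_post G a1 q \<Longrightarrow> rank G a1 pi \<le> rank G a1 q"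
    using assms(5) by (auto simp: highest_ranked_non_f_post_def)
  have matched: "(a1, pi) \<in> M" if "rank_maximal H M" for M
    using rank_maximal_matches_unique_first[OF bip assms(2) pi(2) assms(6-9) that] .
  have le: "rank G a1 pi \<le> rank G a1 q"
    if "rank_maximal G M'" "(a1, q) \<in> M'" "rank G a1 q > 1" for M' q
  proof (rule best)
    show "non_f_post G a1 q" using nonfirst_post_is_non_f_post[OF bip that] .
    show "q \<in> pref_list G a1"
      using that(1,2) by (auto simp: rank_maximal_def matching_def pref_list_def)
  qed
  \<comment> \<open>The witness is \<open>pi\<close>: each \<open>q\<close> minimized over satisfies
    the premises of \<open>le\<close>.\<close>
  have "realizes_best_nonfirst G a1 H"
    unfolding realizes_best_nonfirst_def
    using matched le pi(1) by (auto simp: is_arg_min_def truthful_nonfirst_posts_def)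
  with matched le show ?thesis by blast
qed

end
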